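(* Let $\alpha>0$ and $\beta>1$, and let $D_{\widetilde f_\beta}$ be the asymmetrically-relaxed $f$-divergence with associated convex function $f(u)=u\log u$; that is, $\widetilde f_\beta$ is the partially linearized function of this $f$. For a function $v:\mathcal S\to\mathbb R$ put $$e_v(s,a)=\log\frac{d^E(s,a)}{d^U(s,a)}+\gamma\sum_{s'}T(s'|s,a)v(s')-v(s),$$ and define $$h^\dagger(\omega(s,a))=\omega(s,a)e_v(s,a)-\omega(s,a)\log(\omega(s,a))-\alpha\,\hat r(s,a)\,\widetilde f_\beta\left(\frac{\omega(s,a)}{\hat r(s,a)}\right),$$ $$L^\dagger_{\alpha,\beta}(\omega,v)=\mathbb E_{d^U(s,a)}[h^\dagger(\omega(s,a))]+(1-\gamma)\,\mathbb E_{p_0(s)}[v(s)].$$ Then the closed-form solution $\omega_v^*=\arg\max_{\omega\ge 0}L^\dagger_{\alpha,\beta}(\omega,v)$ is $$\omega_v^*(s,a)=\begin{cases}\exp\left(\frac{e_v(s,a)+\alpha\log\hat r(s,a)}{1+\alpha}-1\right)&\text{if } \frac{e_v(s,a)-\log\hat r(s,a)}{\alpha+1}>\log\beta+1,\\[4pt] \exp\left(e_v(s,a)-1-\alpha(\log\beta+1)\right)&\text{otherwise,}\end{cases}$$ and $$h^\dagger(\omega_v^*(s,a))=\begin{cases}(1+\alpha)\exp\left(\frac{e_v(s,a)+\alpha\log\hat r(s,a)}{1+\alpha}-1\right)+C_3&\text{if } \frac{e_v(s,a)-\log\hat r(s,a)}{\alpha+1}>\log\beta+1,\\[4pt] \exp\left(e_v(s,a)-1-\alpha(\log\beta+1)\right)+C_4&\text{otherwise,}\end{cases}$$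 where $C_3=-\alpha C_{f,\beta}\,\hat r(s,a)$ and $C_4=\alpha(\log\beta+1)\,\hat r(s,a)$ are constants with respect to $\omega$ and $v$.
   Context: Setting: a Markov decision process with state set $\mathcal S$, action set $\mathcal A$, transition distribution $T(s'|s,a)$, initial state distribution $p_0$ on $\mathcal S$, and discount factor $\gamma\in[0,1]$. A policy $\pi$ maps states to distributions over actions and induces the stationary state-action distribution (occupancy measure) $d^\pi(s,a)=(1-\gamma)\sum_{t=0}^\infty\gamma^t\Pr(s_t=s,a_t=a)$, where $s_0\sim p_0$, $a_t\sim\pi(\cdot|s_t)$, $s_{t+1}\sim T(\cdot|s_t,a_t)$. The distributions $d^E$ and $d^U$ on $\mathcal S\times\mathcal A$ are the occupancy measures of an expert policy and of an unknown behavior policy respectively, with $d^U(s,a)>0$ for all $(s,a)$. The function $\hat r(s,a)\approx d^E(s,a)/d^U(s,a)$ is an approximate density ratio (no accuracy is assumed), obtained from a classifier $c:\mathcal S\times\mathcal A\to(0,1)$ as $\hat r=c/(1-c)$, so $\hat r>0$. The variable $\omega$ is a nonnegative function on $\mathcal S\times\mathcal A$ (standing for a ratio $d/d^U$ of an occupancy measure $d$ to $d^U$), and $v$ plays the role of Lagrange multipliers indexed by states. Relaxed divergence: given $\beta>1$ and a strictly convex continuous function $f:\mathbb R_+\to\mathbb R$ with $f(1)=0$, the asymmetrically-relaxed $f$-divergence between distributions $p$ and $q$ on a domain $\mathcal X$ is $$D_{\widetilde f_\beta}(p\|q)=\int_{\mathcal X}q(x)\,\widetilde f_\beta\left(\frac{p(x)}{q(x)}\right)dx,$$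 where $$\widetilde f_\beta(u)=\begin{cases}f(u)+C_{f,\beta}&\text{if }u\ge\beta,\\ f'(\beta)u-f'(\beta)&\text{if }u<\beta,\end{cases}\qquad C_{f,\beta}=-f(\beta)+f'(\beta)(\beta-1).$$ Here $\log$ is the natural logarithm, with $0\log 0=0$. *)

theory Defs
  imports "HOL-Probability.Probability"
begin

text \<open>States and actions are the types \<open>'s\<close> and \<open>'a\<close>, not assumed finite.  A transition
  distribution is a family of type \<open>'s \<Rightarrow> 'a \<Rightarrow> 's pmf\<close>, a policy a family of type \<open>'s \<Rightarrow> 'a pmf\<close>.\<close>

text \<open>The joint distribution of state and action at time \<open>t\<close>.\<close>

primrec sa_dist ::
  "'s pmf \<Rightarrow> ('s \<Rightarrow> 'a \<Rightarrow> 's pmf) \<Rightarrow> ('s \<Rightarrow> 'a pmf) \<Rightarrow> nat \<Rightarrow> ('s \<times> 'a) pmf" where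
  "sa_dist p0 T \<pi> 0 = bind_pmf p0 (\<lambda>s. map_pmf (Pair s) (\<pi> s))"
| "sa_dist p0 T \<pi> (Suc t) =
     bind_pmf (sa_dist p0 T \<pi> t) (\<lambda>(s, a). bind_pmf (T s a) (\<lambda>s'. map_pmf (Pair s') (\<pi> s')))"

text \<open>The series converges for \<open>0 \<le> \<gamma> < 1\<close>.  For \<open>\<gamma> = 1\<close> the factor \<open>1 - \<gamma>\<close> makes the value \<open>0\<close>.\<close>

definition occupancy ::
  "real \<Rightarrow> 's pmf \<Rightarrow> ('s \<Rightarrow> 'a \<Rightarrow> 's pmf) \<Rightarrow> ('s \<Rightarrow> 'a pmf) \<Rightarrow> 's \<Rightarrow> 'a \<Rightarrow> real" where
  "occupancy \<gamma> p0 T \<pi> s a = (1 - \<gamma>) * (\<Sum>t. \<gamma> ^ t * pmf (sa_dist p0 T \<pi> t) (s, a))"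

definition density_ratio :: "('s \<Rightarrow> 'a \<Rightarrow> real) \<Rightarrow> 's \<Rightarrow> 'a \<Rightarrow> real" where
  "density_ratio c s a = c s a / (1 - c s a)"

definition relax_const :: "(real \<Rightarrow> real) \<Rightarrow> real \<Rightarrow> real" where
  "relax_const f \<beta> = - f \<beta> + deriv f \<beta> * (\<beta> - 1)"

definition relaxed :: "(real \<Rightarrow> real) \<Rightarrow> real \<Rightarrow> real \<Rightarrow> real" where
  "relaxed f \<beta> u = (if u \<ge> \<beta> then f u + relax_const f \<beta> else deriv f \<beta> * u - deriv f \<beta>)"

text \<open>Since \<open>ln 0 = 0\<close> on the reals, this is \<open>u log u\<close> with the convention \<open>0 log 0 = 0\<close>.\<close>

definition xlogx :: "real \<Rightarrow> real" where
  "xlogx u = u * ln u"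

text \<open>The expert occupancy measure may vanish, so its logarithm is taken in the extended reals:
  \<open>log 0 = -\<infinity>\<close> and \<open>exp (-\<infinity>) = 0\<close>.  The exponential is only needed at arguments below \<open>\<infinity>\<close>.\<close>

definition log_ext :: "real \<Rightarrow> ereal" where
  "log_ext x = (if x = 0 then -\<infinity> else ereal (ln x))"

definition exp_ext :: "ereal \<Rightarrow> real" where
  "exp_ext x = (if x = -\<infinity> then 0 else exp (real_of_ereal x))"

definition e_v ::
  "real \<Rightarrow> ('s \<Rightarrow> 'a \<Rightarrow> 's pmf) \<Rightarrow> ('s \<times> 'a) pmf \<Rightarrow> ('s \<times> 'a) pmf \<Rightarrow> ('s \<Rightarrow> real) \<Rightarrow> 's \<Rightarrow> 'a \<Rightarrow> ereal" where
  "e_v \<gamma> T dE dU v s a =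
     log_ext (pmf dE (s, a) / pmf dU (s, a))
     + ereal (\<gamma> * (\<Sum>\<^sub>\<infinity>s'. pmf (T s a) s' * v s') - v s)"

text \<open>The integrand at one state-action pair, where \<open>r\<close> and \<open>e\<close> are the values of the density ratio and
  of \<open>e_v\<close> there, and \<open>x\<close> is the value of the nonnegative variable.  If \<open>e = -\<infinity>\<close>, the extended
  reals give \<open>x * e = 0\<close> for \<open>x = 0\<close> and \<open>x * e = -\<infinity>\<close> for \<open>x > 0\<close>.\<close>

definition h_dagger :: "real \<Rightarrow> real \<Rightarrow> real \<Rightarrow> ereal \<Rightarrow> real \<Rightarrow> ereal" where
  "h_dagger \<alpha> \<beta> r e x =
     ereal x * e - ereal (xlogx x) - ereal (\<alpha> * r * relaxed xlogx \<beta> (x / r))"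

text \<open>Integral of the positive part minus integral of the negative part.\<close>

definition ereal_expectation :: "'b pmf \<Rightarrow> ('b \<Rightarrow> ereal) \<Rightarrow> ereal" where
  "ereal_expectation d g =
     enn2ereal (\<integral>\<^sup>+ x. e2ennreal (g x) \<partial>measure_pmf d)
     - enn2ereal (\<integral>\<^sup>+ x. e2ennreal (- g x) \<partial>measure_pmf d)"

definition L_dagger ::
  "real \<Rightarrow> real \<Rightarrow> real \<Rightarrow> 's pmf \<Rightarrow> ('s \<Rightarrow> 'a \<Rightarrow> 's pmf) \<Rightarrow> ('s \<times> 'a) pmf \<Rightarrow> ('s \<times> 'a) pmf \<Rightarrow>
   ('s \<Rightarrow> 'a \<Rightarrow> real) \<Rightarrow> ('s \<Rightarrow> 'a \<Rightarrow> real) \<Rightarrow> ('s \<Rightarrow> real) \<Rightarrow> ereal" where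
  "L_dagger \<alpha> \<beta> \<gamma> p0 T dE dU r \<omega> v =
     ereal_expectation dU (\<lambda>(s, a). h_dagger \<alpha> \<beta> (r s a) (e_v \<gamma> T dE dU v s a) (\<omega> s a))
     + ereal ((1 - \<gamma>) * measure_pmf.expectation p0 v)"

definition above_threshold :: "real \<Rightarrow> real \<Rightarrow> real \<Rightarrow> ereal \<Rightarrow> bool" where
  "above_threshold \<alpha> \<beta> r e \<longleftrightarrow> (e - ereal (ln r)) / ereal (\<alpha> + 1) > ereal (ln \<beta> + 1)"

definition omega_star :: "real \<Rightarrow> real \<Rightarrow> real \<Rightarrow> ereal \<Rightarrow> real" where
  "omega_star \<alpha> \<beta> r e =
     (if above_threshold \<alpha> \<beta> r e
      then exp_ext ((e + ereal (\<alpha> * ln r)) / ereal (1 + \<alpha>) - 1)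
      else exp_ext (e - 1 - ereal (\<alpha> * (ln \<beta> + 1))))"

end

theory Submission
  imports Defs
begin

text \<open>At a pair with finite \<open>e\<close> the integrand is a strictly concave function of \<open>x\<close>, and \<open>omega_star\<close>
  is the zero of its derivative: comparing with the tangents at that point of the two convex
  summands \<open>x log x\<close> and \<open>\<alpha> r relaxed xlogx \<beta> (x / r)\<close> shows that it is the unique pointwise
  maximiser.  The maximal value is at least the value at \<open>x = 0\<close>, which is positive, so the
  integrand at \<open>omega_star\<close> has no negative part.  Hence the expectation is maximised pointwise, and
  if the maximum is finite, a competitor reaching it agrees with the pointwise maximum on the
  support of \<open>dU\<close>, which is everything.\<close>

section \<open>Tangents of the convex generators\<close>

text \<open>For positive x, division by x turns this into \<open>ln t < t - 1\<close> at t = y / x,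
  which differs from 1. Strictness here is what makes the maximiser unique, since
  \<open>relaxed\<close> has a linear piece.\<close>

lemma xlogx_tangent_less:
  assumes "0 \<le> x" "0 < y" "x \<noteq> y"
  shows "x * ln y + x - y < xlogx x"
proof (cases "x = 0")
  case True
  then show ?thesis using assms by (simp add: xlogx_def)
next
  case False
  with assms have x: "0 < x" by simp
  have "ln (y / x) \<noteq> y / x - 1"
    using ln_eq_minus_one[of "y / x"] assms x by auto
  moreover have "ln (y / x) \<le> y / x - 1"
    using ln_le_minus_one[of "y / x"] assms x by simp
  ultimately have "ln y - ln x < y / x - 1"
    using assms x by (simp add: ln_div)
  then have "x * (ln y - ln x) < x * (y / x - 1)"
    using x by simp
  then show ?thesis using x by (simp add: xlogx_def algebra_simps)
qed

lemma xlogx_tangent_le: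
  assumes "0 \<le> x" "0 < y"
  shows "x * ln y + x - y \<le> xlogx x"
  using xlogx_tangent_less[OF assms] by (cases "x = y") (auto simp: xlogx_def)

lemma deriv_xlogx:
  assumes "0 < x"
  shows "deriv xlogx x = ln x + 1"
proof -
  have "((\<lambda>u. u * ln u) has_real_derivative ln x + 1) (at x)"
    using assms by (auto intro!: derivative_eq_intros)
  moreover have "xlogx = (\<lambda>u. u * ln u)" by (auto simp: xlogx_def)
  ultimately show ?thesis by (metis DERIV_imp_deriv)
qed

lemma relaxed_xlogx:
  assumes "0 < \<beta>"
  shows "relaxed xlogx \<beta> u =
    (if u \<ge> \<beta> then xlogx u + (\<beta> - ln \<beta> - 1) else (ln \<beta> + 1) * (u - 1))"
  using assms by (simp add: relaxed_def relax_const_def deriv_xlogx xlogx_def algebra_simps)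

text \<open>On the linear piece the tangent at \<open>w\<close> is the tangent at \<open>\<beta>\<close>, whence \<open>max \<beta> w\<close>.\<close>

lemma relaxed_xlogx_tangent_le:
  assumes "0 < \<beta>" "0 \<le> u"
  shows "relaxed xlogx \<beta> w + (ln (max \<beta> w) + 1) * (u - w) \<le> relaxed xlogx \<beta> u"
proof -
  define m where "m = max \<beta> w"
  have m: "\<beta> \<le> m" "0 < m" using assms by (auto simp: m_def)
  \<comment> \<open>The tangent of \<open>relaxed\<close> at w is the tangent of
    \<open>xlogx\<close> at m, raised by the constant of the upper branch.\<close>
  have "relaxed xlogx \<beta> w + (ln m + 1) * (u - w) = \<beta> - ln \<beta> - 1 + (u * ln m + u - m)"
    using assms by (auto simp: relaxed_xlogx m_def xlogx_def max_def algebra_simps)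
  also have "\<dots> \<le> relaxed xlogx \<beta> u"
  proof (cases "u \<ge> \<beta>")
    case True
    then show ?thesis
      using xlogx_tangent_le[of u m] assms m by (simp add: relaxed_xlogx)
  next
    case False
    \<comment> \<open>The gap between the linear piece and the tangent is m - \<beta> - u * (ln m -
      ln \<beta>), nonincreasing in u because m \<ge> \<beta>. So u = \<beta> is the worst case, and
      there the tangent inequality of \<open>xlogx\<close> applies.\<close>
    have "u * (ln m - ln \<beta>) \<le> \<beta> * (ln m - ln \<beta>)"
      using False m assms by (intro mult_right_mono) auto
    also have "\<dots> \<le> m - \<beta>"
      using xlogx_tangent_le[of \<beta> m] assms m by (simp add: xlogx_def algebra_simps)
    finally show ?thesis
      using False assms by (simp add: relaxed_xlogx algebra_simps)
  qed
  finally show ?thesis by (simp add: m_def)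
qed

section \<open>Pointwise maximisation\<close>

lemma h_dagger_ereal:
  "h_dagger \<alpha> \<beta> r (ereal e) x = ereal (x * e - xlogx x - \<alpha> * r * relaxed xlogx \<beta> (x / r))"
  by (simp add: h_dagger_def)

lemma h_dagger_minus_infinity:
  "h_dagger \<alpha> \<beta> r (-\<infinity>) x =
    (if x = 0 then ereal (- (\<alpha> * r * relaxed xlogx \<beta> 0)) else if x > 0 then -\<infinity> else \<infinity>)"
  by (simp add: h_dagger_def xlogx_def)

text \<open>The product 0 * e is 0 for infinite e too, so one formula covers every e.\<close>

lemma h_dagger_zero:
  assumes "0 < \<beta>" "0 < r"
  shows "h_dagger \<alpha> \<beta> r e 0 = ereal (\<alpha> * (ln \<beta> + 1) * r)"
  using assms
  by (simp add: h_dagger_def xlogx_def relaxed_xlogx algebra_simps flip: zero_ereal_def)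

lemma above_threshold_ereal:
  assumes "0 < \<alpha>"
  shows "above_threshold \<alpha> \<beta> r (ereal e) \<longleftrightarrow> (e - ln r) / (\<alpha> + 1) > ln \<beta> + 1"
  using assms by (simp add: above_threshold_def)

lemma not_above_threshold_minus_infinity:
  assumes "0 < \<alpha>"
  shows "\<not> above_threshold \<alpha> \<beta> r (-\<infinity>)"
  using assms by (simp add: above_threshold_def)

lemma omega_star_minus_infinity:
  assumes "0 < \<alpha>"
  shows "omega_star \<alpha> \<beta> r (-\<infinity>) = 0"
  using assms by (simp add: omega_star_def not_above_threshold_minus_infinity exp_ext_def one_ereal_def)

lemma omega_star_ereal:
  assumes "0 < \<alpha>"
  shows "omega_star \<alpha> \<beta> r (ereal e) =
    (if above_threshold \<alpha> \<beta> r (ereal e) then exp ((e + \<alpha> * ln r) / (1 + \<alpha>) - 1)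
     else exp (e - 1 - \<alpha> * (ln \<beta> + 1)))"
  using assms by (simp add: omega_star_def exp_ext_def one_ereal_def)

lemma omega_star_nonneg: "0 \<le> omega_star \<alpha> \<beta> r e"
  by (simp add: omega_star_def exp_ext_def)

text \<open>The closed form branches on e, but \<open>relaxed\<close> branches on x / r. Taking
  logarithms, either branch of \<open>omega_star\<close> reduces the comparison to e - ln r against
  (1 + \<alpha>) * (ln \<beta> + 1), so the two case distinctions agree.\<close>

lemma above_threshold_iff_ratio:
  assumes "0 < \<alpha>" "0 < \<beta>" "0 < r"
  shows "above_threshold \<alpha> \<beta> r (ereal e) \<longleftrightarrow> \<beta> < omega_star \<alpha> \<beta> r (ereal e) / r"
proof -
  let ?x = "omega_star \<alpha> \<beta> r (ereal e)"
  have x: "0 < ?x" using assms by (simp add: omega_star_ereal)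
  have "\<beta> < ?x / r \<longleftrightarrow> ln \<beta> < ln (?x / r)"
    using assms x by (subst ln_less_cancel_iff) auto
  also have "\<dots> \<longleftrightarrow> ln \<beta> < ln ?x - ln r"
    using assms x by (simp add: ln_div)
  also have "\<dots> \<longleftrightarrow> (e - ln r) / (\<alpha> + 1) > ln \<beta> + 1"
    using assms by (auto simp: omega_star_ereal above_threshold_ereal field_simps)
  finally show ?thesis using assms by (simp add: above_threshold_ereal)
qed

text \<open>The left side is the derivative of the integrand at x0. Once it is known which term
  attains the maximum, the equation is linear in ln x0, and its solutions are the two exponents of
  \<open>omega_star\<close>.\<close>

lemma omega_star_critical:
  fixes e :: real
  assumes "0 < \<alpha>" "0 < \<beta>" "0 < r"
  defines "x0 \<equiv> omega_star \<alpha> \<beta> r (ereal e)"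
  shows "e - (ln x0 + 1) - \<alpha> * (ln (max \<beta> (x0 / r)) + 1) = 0"
proof (cases "above_threshold \<alpha> \<beta> r (ereal e)")
  case True
  then have "max \<beta> (x0 / r) = x0 / r"
    using above_threshold_iff_ratio[OF assms(1-3)] by (simp add: x0_def)
  moreover have "0 < x0" using assms by (simp add: x0_def omega_star_ereal)
  ultimately have lnM: "ln (max \<beta> (x0 / r)) = ln x0 - ln r"
    using assms by (simp add: ln_div)
  have "ln x0 = (e + \<alpha> * ln r) / (1 + \<alpha>) - 1"
    using True assms by (simp add: x0_def omega_star_ereal)
  then have "(1 + \<alpha>) * (ln x0 + 1) = e + \<alpha> * ln r"
    using assms(1) by simp
  then show ?thesis unfolding lnM by (simp add: algebra_simps)
next
  case False
  then have "max \<beta> (x0 / r) = \<beta>"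
    using above_threshold_iff_ratio[OF assms(1-3)] by (simp add: x0_def)
  then show ?thesis using False assms by (simp add: x0_def omega_star_ereal)
qed

lemma h_dagger_less_omega_star:
  assumes "0 < \<alpha>" "0 < \<beta>" "0 < r" "e \<noteq> \<infinity>" "0 \<le> x" "x \<noteq> omega_star \<alpha> \<beta> r e"
  shows "h_dagger \<alpha> \<beta> r e x < h_dagger \<alpha> \<beta> r e (omega_star \<alpha> \<beta> r e)"
proof (cases e)
  case (real q)
  define x0 where "x0 = omega_star \<alpha> \<beta> r (ereal q)"
  define M where "M = ln (max \<beta> (x0 / r)) + 1"
  have x0: "0 < x0" using assms by (simp add: x0_def omega_star_ereal)
  \<comment> \<open>Scaling the argument by 1 / r and the value by \<alpha> * r leaves slope
    \<alpha> * M in x.\<close>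
  have "\<alpha> * r * (relaxed xlogx \<beta> (x0 / r) + M * (x / r - x0 / r)) \<le> \<alpha> * r * relaxed xlogx \<beta> (x / r)"
    unfolding M_def using assms by (intro mult_left_mono relaxed_xlogx_tangent_le) auto
  then have "\<alpha> * r * relaxed xlogx \<beta> (x0 / r) + \<alpha> * M * (x - x0) \<le> \<alpha> * r * relaxed xlogx \<beta> (x / r)"
    using assms(3) by (simp add: algebra_simps)
  moreover have "xlogx x0 + (ln x0 + 1) * (x - x0) < xlogx x"
    using xlogx_tangent_less[of x x0] assms x0 real by (simp add: x0_def xlogx_def algebra_simps)
  \<comment> \<open>Criticality makes the slopes of the two tangents add up to q, so subtracting
    both bounds from x * q leaves no linear remainder.\<close>
  moreover have "(q - (ln x0 + 1) - \<alpha> * M) * (x - x0) = 0"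
    using omega_star_critical[OF assms(1-3), of q] by (simp add: x0_def M_def)
  ultimately have "x * q - xlogx x - \<alpha> * r * relaxed xlogx \<beta> (x / r)
      < x0 * q - xlogx x0 - \<alpha> * r * relaxed xlogx \<beta> (x0 / r)"
    by (simp add: algebra_simps)
  then show ?thesis by (simp add: real h_dagger_ereal x0_def)
next
  case MInf
  \<comment> \<open>Here the maximiser is 0 with a finite value, and every other admissible x is
    positive with value -\<infinity>.\<close>
  then show ?thesis using assms
    by (simp add: h_dagger_minus_infinity omega_star_minus_infinity)
qed (use assms in simp)

lemma h_dagger_le_omega_star:
  assumes "0 < \<alpha>" "0 < \<beta>" "0 < r" "e \<noteq> \<infinity>" "0 \<le> x"
  shows "h_dagger \<alpha> \<beta> r e x \<le> h_dagger \<alpha> \<beta> r e (omega_star \<alpha> \<beta> r e)"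
  using h_dagger_less_omega_star[OF assms] by (cases "x = omega_star \<alpha> \<beta> r e") auto

lemma h_dagger_omega_star:
  assumes "0 < \<alpha>" "0 < \<beta>" "0 < r" "e \<noteq> \<infinity>"
  shows "h_dagger \<alpha> \<beta> r e (omega_star \<alpha> \<beta> r e) =
    (if above_threshold \<alpha> \<beta> r e
     then ereal ((1 + \<alpha>) * exp_ext ((e + ereal (\<alpha> * ln r)) / ereal (1 + \<alpha>) - 1)
                 + (- \<alpha> * relax_const xlogx \<beta> * r))
     else ereal (exp_ext (e - 1 - ereal (\<alpha> * (ln \<beta> + 1))) + \<alpha> * (ln \<beta> + 1) * r))"
proof (cases e)
  case (real q)
  define x0 where "x0 = omega_star \<alpha> \<beta> r (ereal q)"
  \<comment> \<open>Multiplied by x0, the critical equation expresses x0 * q by the terms that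
    cancel all logarithms of x0 in the integrand.\<close>
  have crit: "x0 * (q - (ln x0 + 1) - \<alpha> * (ln (max \<beta> (x0 / r)) + 1)) = 0"
    using omega_star_critical[OF assms(1-3), of q] by (simp add: x0_def)
  note ratio = above_threshold_iff_ratio[OF assms(1-3), of q, folded x0_def]
  show ?thesis
  proof (cases "above_threshold \<alpha> \<beta> r (ereal q)")
    case True
    have "relaxed xlogx \<beta> (x0 / r) = x0 / r * ln (x0 / r) + relax_const xlogx \<beta>"
      using True ratio by (simp add: relaxed_def xlogx_def)
    moreover have "max \<beta> (x0 / r) = x0 / r" using True ratio by simp
    ultimately have "x0 * q - xlogx x0 - \<alpha> * r * relaxed xlogx \<beta> (x0 / r)
        = (1 + \<alpha>) * x0 + (- \<alpha> * relax_const xlogx \<beta> * r)"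
      using crit assms(3) by (simp add: xlogx_def algebra_simps)
    then have "h_dagger \<alpha> \<beta> r e (omega_star \<alpha> \<beta> r e) =
        ereal ((1 + \<alpha>) * omega_star \<alpha> \<beta> r e + (- \<alpha> * relax_const xlogx \<beta> * r))"
      by (simp add: real h_dagger_ereal x0_def)
    then show ?thesis using True by (simp add: real omega_star_def)
  next
    case False
    then have max: "max \<beta> (x0 / r) = \<beta>" using ratio by simp
    \<comment> \<open>The lower case includes x0 / r = \<beta>, where \<open>relaxed\<close> takes
      its upper branch; the additive constant makes both branches agree there.\<close>
    have linear: "relaxed xlogx \<beta> (x0 / r) = (ln \<beta> + 1) * (x0 / r - 1)"
      using False ratio assms(2)
      by (cases "x0 / r = \<beta>") (auto simp: relaxed_xlogx xlogx_def algebra_simps)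
    have "\<alpha> * r * relaxed xlogx \<beta> (x0 / r) = \<alpha> * ((ln \<beta> + 1) * (x0 - r))"
      unfolding linear using assms(3) by (simp add: field_simps)
    then have "x0 * q - xlogx x0 - \<alpha> * r * relaxed xlogx \<beta> (x0 / r)
        = x0 + \<alpha> * (ln \<beta> + 1) * r"
      using crit unfolding max by (simp add: xlogx_def algebra_simps)
    then have "h_dagger \<alpha> \<beta> r e (omega_star \<alpha> \<beta> r e) =
        ereal (omega_star \<alpha> \<beta> r e + \<alpha> * (ln \<beta> + 1) * r)"
      by (simp add: real h_dagger_ereal x0_def)
    then show ?thesis using False by (simp add: real omega_star_def)
  qed
next
  case MInf
  then show ?thesis using assms
    by (simp add: not_above_threshold_minus_infinity omega_star_minus_infinity h_dagger_zero
        exp_ext_def one_ereal_def)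
qed (use assms in simp)

section \<open>Expectations of extended real functions\<close>

lemma ereal_expectation_mono:
  assumes "\<And>x. g x \<le> h x"
  shows "ereal_expectation d g \<le> ereal_expectation d h"
  unfolding ereal_expectation_def
  by (intro ereal_minus_mono)
    (auto intro!: nn_integral_mono e2ennreal_mono simp: less_eq_ennreal.rep_eq[symmetric] assms)

lemma ereal_expectation_nonneg:
  assumes "\<And>x. 0 \<le> h x"
  shows "ereal_expectation d h = enn2ereal (\<integral>\<^sup>+ x. e2ennreal (h x) \<partial>measure_pmf d)"
proof -
  have "e2ennreal (- h x) = 0" for x
    using assms[of x] by (intro e2ennreal_neg) simp
  then show ?thesis by (simp add: ereal_expectation_def zero_ennreal.rep_eq)
qed

lemma ereal_expectation_eq_imp_eq:
  assumes le: "\<And>x. g x \<le> h x" and nonneg: "\<And>x. 0 \<le> h x"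
    and fin: "ereal_expectation d h < \<infinity>"
    and eq: "ereal_expectation d g = ereal_expectation d h"
    and x: "x \<in> set_pmf d"
  shows "g x = h x"
proof -
  define H where "H = (\<integral>\<^sup>+ x. e2ennreal (h x) \<partial>measure_pmf d)"
  define P where "P = (\<integral>\<^sup>+ x. e2ennreal (g x) \<partial>measure_pmf d)"
  define N where "N = (\<integral>\<^sup>+ x. e2ennreal (- g x) \<partial>measure_pmf d)"
  have le': "e2ennreal (g x) \<le> e2ennreal (h x)" for x
    by (intro e2ennreal_mono le)
  have H: "enn2ereal H < \<infinity>" and PN: "enn2ereal P - enn2ereal N = enn2ereal H"
    using fin eq ereal_expectation_nonneg[of h d] nonneg
    by (auto simp: H_def P_def N_def ereal_expectation_def[of d g])
  have PH: "enn2ereal P \<le> enn2ereal H"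
    unfolding less_eq_ennreal.rep_eq[symmetric] P_def H_def by (intro nn_integral_mono le')
  have pos: "0 \<le> enn2ereal P" "0 \<le> enn2ereal N" by auto
  \<comment> \<open>P - N = H with P \<le> H, N \<ge> 0 and H finite leaves no slack.\<close>
  have "enn2ereal P = enn2ereal H \<and> enn2ereal N = 0"
    using H PN PH pos
    by (cases "enn2ereal P"; cases "enn2ereal N"; cases "enn2ereal H") auto
  then have P: "P = H" and N: "N = 0"
    by (auto simp: enn2ereal_inject zero_ennreal.rep_eq[symmetric])
  have "P \<noteq> \<infinity>" using H P by auto
  \<comment> \<open>Finiteness of P permits subtracting the integrals. The difference is nonnegative
    with integral 0, so it vanishes at every atom.\<close>
  then have "(\<integral>\<^sup>+ x. (e2ennreal (h x) - e2ennreal (g x)) \<partial>measure_pmf d) = H - P"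
    unfolding H_def P_def by (intro nn_integral_diff) (auto simp: le')
  then have "e2ennreal (h x) - e2ennreal (g x) = 0"
    using P x \<open>P \<noteq> \<infinity>\<close> by (simp add: nn_integral_0_iff_AE AE_measure_pmf_iff)
  then have hg: "e2ennreal (h x) = e2ennreal (g x)"
    using le'[of x] by (auto simp: diff_eq_0_iff_ennreal)
  \<comment> \<open>\<open>e2ennreal\<close> truncates negative values to 0, so \<open>hg\<close>
    alone would allow g x < 0 = h x; the vanishing negative part excludes this.\<close>
  have "e2ennreal (- g x) = 0"
    using N x by (simp add: N_def nn_integral_0_iff_AE AE_measure_pmf_iff)
  then have "0 \<le> g x"
    using enn2ereal_e2ennreal[of "- g x"] by (cases "g x") (auto simp: zero_ennreal.rep_eq ennreal_eq_0_iff)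
  then show ?thesis using hg nonneg[of x] by (metis enn2ereal_e2ennreal)
qed

text \<open>A finite sum of finite terms; this serves the finite alternative of the uniqueness
  claim.\<close>

lemma ereal_expectation_finite:
  fixes d :: "'b pmf"
  assumes "finite (UNIV :: 'b set)" "\<And>x. 0 \<le> h x" "\<And>x. h x < \<infinity>"
  shows "ereal_expectation d h < \<infinity>"
proof -
  have "(\<integral>\<^sup>+ x. e2ennreal (h x) \<partial>measure_pmf d) = (\<Sum>x\<in>set_pmf d. e2ennreal (h x) * ennreal (pmf d x))"
    using finite_subset[OF subset_UNIV assms(1), of "set_pmf d"] by (simp add: nn_integral_measure_pmf_finite)
  also have "\<dots> < \<top>"
  proof -
    have "e2ennreal (h x) < \<top>" for x
      using assms(2)[of x] assms(3)[of x] by (cases "h x") (auto simp flip: ennreal.abs_eq)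
    then show ?thesis
      using finite_subset[OF subset_UNIV assms(1), of "set_pmf d"]
      by (auto simp: ennreal_mult_less_top)
  qed
  finally show ?thesis
    using assms(2) by (simp add: ereal_expectation_nonneg less_ennreal.rep_eq top_ennreal.rep_eq top_ereal_def)
qed

section \<open>From pointwise to global maximisation\<close>

lemma e_v_neq_infinity: "e_v \<gamma> T dE dU v s a \<noteq> \<infinity>"
  by (simp add: e_v_def log_ext_def)

lemma density_ratio_pos:
  assumes "0 < c s a" "c s a < 1"
  shows "0 < density_ratio c s a"
  using assms by (simp add: density_ratio_def)

theorem theorem3:
  fixes \<alpha> \<beta> \<gamma> :: real
    and p0 :: "'s pmf" and T :: "'s \<Rightarrow> 'a \<Rightarrow> 's pmf"
    and \<pi>E \<pi>U :: "'s \<Rightarrow> 'a pmf" and dE dU :: "('s \<times> 'a) pmf"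
    and c :: "'s \<Rightarrow> 'a \<Rightarrow> real" and v :: "'s \<Rightarrow> real"
  assumes "\<alpha> > 0" and "\<beta> > 1" and "0 \<le> \<gamma>" and "\<gamma> \<le> 1"
    and "\<And>s a. pmf dE (s, a) = occupancy \<gamma> p0 T \<pi>E s a"
    and "\<And>s a. pmf dU (s, a) = occupancy \<gamma> p0 T \<pi>U s a"
    and "\<And>s a. pmf dU (s, a) > 0"
    and "\<And>s a. 0 < c s a \<and> c s a < 1"
    and "\<And>s a. (\<lambda>s'. pmf (T s a) s' * v s') summable_on UNIV"
    and "integrable (measure_pmf p0) v"
  shows
    "let r = density_ratio c;
         e = e_v \<gamma> T dE dU v;
         L = (\<lambda>\<omega>. L_dagger \<alpha> \<beta> \<gamma> p0 T dE dU r \<omega> v);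
         nonneg = (\<lambda>\<omega>. \<forall>s a. 0 \<le> \<omega> s a);
         \<omega>s = (\<lambda>s a. omega_star \<alpha> \<beta> (r s a) (e s a))
     in is_arg_max L nonneg \<omega>s \<and>
        (finite (UNIV :: ('s \<times> 'a) set) \<or> L \<omega>s < \<infinity> \<longrightarrow> {\<omega>. is_arg_max L nonneg \<omega>} = {\<omega>s}) \<and>
        (\<forall>s a. h_dagger \<alpha> \<beta> (r s a) (e s a) (\<omega>s s a) =
           (if above_threshold \<alpha> \<beta> (r s a) (e s a)
            then ereal ((1 + \<alpha>) * exp_ext ((e s a + ereal (\<alpha> * ln (r s a))) / ereal (1 + \<alpha>) - 1)
                        + (- \<alpha> * relax_const xlogx \<beta> * r s a))
            else ereal (exp_ext (e s a - 1 - ereal (\<alpha> * (ln \<beta> + 1)))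
                        + \<alpha> * (ln \<beta> + 1) * r s a)))"
proof -
  define r where "r = density_ratio c"
  define e where "e = e_v \<gamma> T dE dU v"
  define L where "L = (\<lambda>\<omega>. L_dagger \<alpha> \<beta> \<gamma> p0 T dE dU r \<omega> v)"
  define nonneg where "nonneg = (\<lambda>\<omega> :: 's \<Rightarrow> 'a \<Rightarrow> real. \<forall>s a. 0 \<le> \<omega> s a)"
  define \<omega>s where "\<omega>s = (\<lambda>s a. omega_star \<alpha> \<beta> (r s a) (e s a))"
  define h where "h = (\<lambda>\<omega> (s, a). h_dagger \<alpha> \<beta> (r s a) (e s a) (\<omega> s a))"
  define K where "K = (1 - \<gamma>) * measure_pmf.expectation p0 v"
  have \<beta>: "0 < \<beta>" using \<open>\<beta> > 1\<close> by simp
  have r: "0 < r s a" for s a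
    using density_ratio_pos[of c s a] assms(8)[of s a] by (simp add: r_def)
  have e: "e s a \<noteq> \<infinity>" for s a
    by (simp add: e_def e_v_neq_infinity)
  have L: "L \<omega> = ereal_expectation dU (h \<omega>) + ereal K" for \<omega>
    by (simp add: L_def L_dagger_def h_def e_def K_def)
  have nn: "nonneg \<omega>s"
    by (simp add: nonneg_def \<omega>s_def omega_star_nonneg)
  have le: "h \<omega> z \<le> h \<omega>s z" if "nonneg \<omega>" for \<omega> z
    using that h_dagger_le_omega_star[OF \<open>\<alpha> > 0\<close> \<beta> r e]
    by (cases z) (auto simp: h_def \<omega>s_def nonneg_def)
  have h_nonneg: "0 \<le> h \<omega>s z" for z
  proof -
    obtain s a where z: "z = (s, a)" by fastforce
    have "0 \<le> \<alpha> * (ln \<beta> + 1) * r s a"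
      using r[of s a] \<open>\<alpha> > 0\<close> \<open>\<beta> > 1\<close> by simp
    then have "0 \<le> h (\<lambda>_ _. 0) z"
      using h_dagger_zero[OF \<beta> r] by (simp add: h_def z)
    also have "\<dots> \<le> h \<omega>s z" by (rule le) (simp add: nonneg_def)
    finally show ?thesis .
  qed
  note val = h_dagger_omega_star[OF \<open>\<alpha> > 0\<close> \<beta> r e]
  have h_fin: "h \<omega>s z < \<infinity>" for z
    by (cases z) (simp add: h_def \<omega>s_def val)
  have L_le: "L \<omega> \<le> L \<omega>s" if "nonneg \<omega>" for \<omega>
    unfolding L by (intro add_right_mono ereal_expectation_mono le that)
  have max: "is_arg_max L nonneg \<omega>s"
    using nn L_le by (auto simp: is_arg_max_def not_less)
  have unique: "\<omega> = \<omega>s"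
    if fin: "finite (UNIV :: ('s \<times> 'a) set) \<or> L \<omega>s < \<infinity>" and \<omega>: "is_arg_max L nonneg \<omega>" for \<omega>
  proof -
    have \<omega>_nn: "nonneg \<omega>" and "L \<omega> = L \<omega>s"
      using \<omega> nn L_le[of \<omega>] by (auto simp: is_arg_max_def)
    \<comment> \<open>K is real, so it cancels even if the expectations are infinite.\<close>
    then have eq: "ereal_expectation dU (h \<omega>) = ereal_expectation dU (h \<omega>s)"
      by (cases "ereal_expectation dU (h \<omega>)"; cases "ereal_expectation dU (h \<omega>s)") (auto simp: L)
    have exp_fin: "ereal_expectation dU (h \<omega>s) < \<infinity>"
      using fin ereal_expectation_finite[of "h \<omega>s" dU] h_nonneg h_fin by (auto simp: L)
    have "\<omega> s a = \<omega>s s a" for s a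
    proof (rule ccontr)
      assume "\<omega> s a \<noteq> \<omega>s s a"
      then have "h \<omega> (s, a) < h \<omega>s (s, a)"
        using h_dagger_less_omega_star[OF \<open>\<alpha> > 0\<close> \<beta> r e] \<omega>_nn
        by (simp add: h_def \<omega>s_def nonneg_def)
      \<comment> \<open>Every pair is an atom of \<open>dU\<close>, so equal expectations force
        equality at this very pair.\<close>
      moreover have "h \<omega> (s, a) = h \<omega>s (s, a)"
        using le[OF \<omega>_nn] h_nonneg exp_fin eq
        by (rule ereal_expectation_eq_imp_eq) (simp add: set_pmf_iff assms(7) less_imp_neq[symmetric])
      ultimately show False by simp
    qed
    then show ?thesis by blast
  qed
  have "finite (UNIV :: ('s \<times> 'a) set) \<or> L \<omega>s < \<infinity> \<longrightarrow> {\<omega>. is_arg_max L nonneg \<omega>} = {\<omega>s}"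
    using max unique by blast
  then show ?thesis
    using max val unfolding Let_def r_def e_def L_def nonneg_def \<omega>s_def by blast
qed

end
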